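(* Let $c\geq 1$ be a real number and for every $n\geq 0$ let $S_n=[-\lceil cn\rceil,\lceil cn\rceil]^2$ (grid graph), $\underline{S}=(S_n)_{n\geq 0}$. For each $\rho\in\left[\frac{1}{2c^2},1\right]$ there is a valid sequence of activated vertices $\underline{v}=(v_n)_{n\geq 0}\in\prod_{n\geq 0}V(S_n)$ (so $v_n\neq\bullet$ for all $n$) such that the burning density $\delta(\underline{S},\underline{v})$ exists and equals $\rho$.
   Context: For integers $a\le b$, $c\le d$, $[a,b]\times[c,d]$ denotes the graph on vertex set $[a,b]\times[c,d]\subset\mathbb{Z}^2$ in which two vertices are adjacent iff their $L_1$-distance is $1$; $[a,b]^2=[a,b]\times[a,b]$. Burning process: let $\underline{G}=(G_0,G_1,\dots)$ be graphs with $G_{n-1}$ an induced subgraph of $G_n$ for all $n\ge1$. A sequence of activated vertices is $\underline{v}=(v_n)_{n\ge0}$ with $v_n\in V(G_n)\cup\{\bullet\}$ ($\bullet$ means no vertex is activated). Burning sets: $B_0=\{v_0\}$ (empty if $v_0=\bullet$), and $B_{n+1}=N_{G_{n+1}}[B_n]$ if $v_{n+1}=\bullet$, and $B_{n+1}=N_{G_{n+1}}[B_n]\cup\{v_{n+1}\}$ otherwise, where $N_G[X]$ is the closed neighbourhood of $X$ in $G$. The sequence is valid if for every $n\ge0$ with $v_{n+1}\neq\bullet$, $v_{n+1}\in V(G_{n+1})\setminus N_{G_{n+1}}[B_n]$. The burning density is $\delta(\underline{G},\underline{v})=\lim_{n\to\infty}|B_n|/|V(G_n)|$ when the limit exists.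 *)

theory Defs
  imports Complex_Main "Graph_Theory.Graph_Theory"
begin

text \<open>Simple graphs are loop-free symmetric digraphs, with each edge present as two arcs
  (\<^locale>\<open>pair_graph\<close>).\<close>

definition growing_graphs :: "(nat \<Rightarrow> 'a pair_pre_digraph) \<Rightarrow> bool" where
  "growing_graphs G \<longleftrightarrow>
     (\<forall>n. pair_graph (G n)) \<and>
     (\<forall>n. induced_subgraph (with_proj (G n)) (with_proj (G (Suc n))))"

definition closed_nbhd :: "'a pair_pre_digraph \<Rightarrow> 'a set \<Rightarrow> 'a set" where
  "closed_nbhd G X = X \<union> {y \<in> pverts G. \<exists>x\<in>X. (x, y) \<in> parcs G}"

text \<open>In a sequence of activated vertices, \<^term>\<open>None\<close> means that no vertex is activated.\<close>

primrec burning_set ::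
  "(nat \<Rightarrow> 'a pair_pre_digraph) \<Rightarrow> (nat \<Rightarrow> 'a option) \<Rightarrow> nat \<Rightarrow> 'a set" where
  "burning_set G v 0 = set_option (v 0)"
| "burning_set G v (Suc n) =
     closed_nbhd (G (Suc n)) (burning_set G v n) \<union> set_option (v (Suc n))"

definition activation_sequence ::
  "(nat \<Rightarrow> 'a pair_pre_digraph) \<Rightarrow> (nat \<Rightarrow> 'a option) \<Rightarrow> bool" where
  "activation_sequence G v \<longleftrightarrow> (\<forall>n x. v n = Some x \<longrightarrow> x \<in> pverts (G n))"

definition valid_activation_sequence ::
  "(nat \<Rightarrow> 'a pair_pre_digraph) \<Rightarrow> (nat \<Rightarrow> 'a option) \<Rightarrow> bool" where
  "valid_activation_sequence G v \<longleftrightarrow>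
     activation_sequence G v \<and>
     (\<forall>n x. v (Suc n) = Some x \<longrightarrow>
        x \<in> pverts (G (Suc n)) - closed_nbhd (G (Suc n)) (burning_set G v n))"

text \<open>The burning density exists and equals \<^term>\<open>d\<close>.\<close>

definition has_burning_density ::
  "(nat \<Rightarrow> 'a pair_pre_digraph) \<Rightarrow> (nat \<Rightarrow> 'a option) \<Rightarrow> real \<Rightarrow> bool" where
  "has_burning_density G v d \<longleftrightarrow>
     (\<lambda>n. real (card (burning_set G v n)) / real (card (pverts (G n)))) \<longlonglongrightarrow> d"

definition l1_dist :: "int \<times> int \<Rightarrow> int \<times> int \<Rightarrow> int" where
  "l1_dist p q = \<bar>fst p - fst q\<bar> + \<bar>snd p - snd q\<bar>"

definition grid_graph :: "int \<Rightarrow> int \<Rightarrow> int \<Rightarrow> int \<Rightarrow> (int \<times> int) pair_pre_digraph" where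
  "grid_graph a b c d =
     \<lparr> pverts = {a..b} \<times> {c..d},
       parcs = {(p, q). p \<in> {a..b} \<times> {c..d} \<and> q \<in> {a..b} \<times> {c..d} \<and> l1_dist p q = 1} \<rparr>"

definition growing_squares :: "real \<Rightarrow> nat \<Rightarrow> (int \<times> int) pair_pre_digraph" where
  "growing_squares c n =
     grid_graph (- \<lceil>c * real n\<rceil>) \<lceil>c * real n\<rceil> (- \<lceil>c * real n\<rceil>) \<lceil>c * real n\<rceil>"

lemma pair_graph_grid_graph: "pair_graph (grid_graph a b c d)"
proof -
  let ?V = "{a..b} \<times> {c..d}"
  have "parcs (grid_graph a b c d) \<subseteq> ?V \<times> ?V"
    by (auto simp: grid_graph_def)
  then have fin: "finite (parcs (grid_graph a b c d))"
    by (rule finite_subset) simp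
  show ?thesis
    using fin
    by unfold_locales
      (auto simp: grid_graph_def l1_dist_def symmetric_def sym_def abs_minus_commute)
qed

lemma growing_graphs_growing_squares:
  assumes "c \<ge> 0"
  shows "growing_graphs (growing_squares c)"
proof -
  have wf: "wf_digraph (with_proj (grid_graph a b a' b'))" for a b a' b'
    by unfold_locales (auto simp: grid_graph_def)
  have mono: "\<lceil>c * real n\<rceil> \<le> \<lceil>c * real (Suc n)\<rceil>" for n
    using assms by (intro ceiling_mono mult_left_mono) auto
  have ind: "induced_subgraph (with_proj (grid_graph (- k) k (- k) k))
      (with_proj (grid_graph (- l) l (- l) l))" if "k \<le> l" for k l
    unfolding induced_subgraph_def subgraph_def compatible_def
  proof (intro conjI wf)
    show "verts (with_proj (grid_graph (- k) k (- k) k))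
        \<subseteq> verts (with_proj (grid_graph (- l) l (- l) l))"
      using that by (auto simp: grid_graph_def)
    show "arcs (with_proj (grid_graph (- k) k (- k) k))
        \<subseteq> arcs (with_proj (grid_graph (- l) l (- l) l))"
      using that by (auto simp: grid_graph_def)
    show "arcs (with_proj (grid_graph (- k) k (- k) k)) =
        {e \<in> arcs (with_proj (grid_graph (- l) l (- l) l)).
          tail (with_proj (grid_graph (- l) l (- l) l)) e
            \<in> verts (with_proj (grid_graph (- k) k (- k) k)) \<and>
          head (with_proj (grid_graph (- l) l (- l) l)) e
            \<in> verts (with_proj (grid_graph (- k) k (- k) k))}"
      using that by (auto simp: grid_graph_def)
  qed simp_all
  have "induced_subgraph (with_proj (growing_squares c n))
      (with_proj (growing_squares c (Suc n)))" for n
    unfolding growing_squares_def by (rule ind [OF mono])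
  then show ?thesis
    by (simp add: growing_graphs_def growing_squares_def pair_graph_grid_graph)
qed

end

theory Submission
  imports Defs "HOL-Library.Discrete_Functions" "HOL-Real_Asymp.Real_Asymp"
begin

text \<open>Since \<open>c \<ge> 1\<close>, fire never feels the boundary of the growing squares, and the burning set at
  time \<open>n\<close> is the union of the \<open>\<ell>\<^sub>1\<close>-balls of radius \<open>n - m\<close> about \<open>v\<^sub>m\<close> for \<open>m \<le> n\<close>. By the
  intermediate value theorem there is \<open>r \<in> [1, 2c]\<close> such that the \<open>\<ell>\<^sub>1\<close>-ball of radius \<open>r\<close> occupies
  the fraction \<open>\<rho>\<close> of the square \<open>[-c, c]\<^sup>2\<close>, and we burn asymptotically the dilates of this shape.

  In the phase \<open>s\<^sup>4 \<le> m < (s + 1)\<^sup>4\<close> there is enough time to activate all points of the dilate by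
  \<open>s\<^sup>4\<close> whose coordinates are multiples of \<open>s\<^sup>3\<close>; these balls cover that dilate after \<open>O(s\<^sup>3)\<close> further
  steps. Whenever the scheduled net point already burns, a filler is activated instead. The fillers
  lie at norm \<open>r m + o(m)\<close>, beyond everything that the earlier net points can reach. In a phase they
  move sideways with speed greater than 1, and their norm jumps up between phases, so that
  no filler is reached by an earlier one. For \<open>r = 2c\<close> the corners of the squares serve as fillers.\<close>

subsection \<open>Burning sets of growing squares\<close>

lemma pverts_growing_squares:
  "pverts (growing_squares c n) =
     {- \<lceil>c * real n\<rceil>..\<lceil>c * real n\<rceil>} \<times> {- \<lceil>c * real n\<rceil>..\<lceil>c * real n\<rceil>}"
  by (simp add: growing_squares_def grid_graph_def)

text \<open>The half-side grows by at least one per step, so the square keeps ahead of the fire.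
  With \<open>r\<close> in place of \<open>c\<close> the same bound compares radii at two
  times.\<close>

lemma ceiling_mult_diff:
  assumes "c \<ge> 1" "m \<le> n"
  shows "\<lceil>c * real m\<rceil> + (int n - int m) \<le> \<lceil>c * real n\<rceil>"
proof -
  have "real n - real m \<le> c * (real n - real m)"
    using assms by (simp add: mult_le_cancel_right1)
  then have "c * real m + (real n - real m) \<le> c * real n"
    by (simp add: algebra_simps)
  then have "\<lceil>c * real m + of_int (int n - int m)\<rceil> \<le> \<lceil>c * real n\<rceil>"
    by (intro ceiling_mono) simp
  then show ?thesis
    by (simp only: ceiling_add_of_int)
qed

lemma l1_ball_subset_growing_squares:
  assumes "c \<ge> 1" "m \<le> n" "x \<in> pverts (growing_squares c m)" "l1_dist x y \<le> int n - int m"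
  shows "y \<in> pverts (growing_squares c n)"
  using ceiling_mult_diff [OF assms(1,2)] assms(3,4)
  by (cases x; cases y) (auto simp: pverts_growing_squares l1_dist_def)

text \<open>All lattice neighbours of a vertex of the current square lie in the next square, so fire
  spreads as in the whole plane lattice.\<close>

lemma closed_nbhd_growing_squares:
  assumes "c \<ge> 1" "X \<subseteq> pverts (growing_squares c n)"
  shows "closed_nbhd (growing_squares c (Suc n)) X = {y. \<exists>x\<in>X. l1_dist x y \<le> 1}"
proof -
  have V: "x \<in> pverts (growing_squares c (Suc n))" "y \<in> pverts (growing_squares c (Suc n))"
    if "x \<in> X" "l1_dist x y \<le> 1" for x y
    using l1_ball_subset_growing_squares [OF assms(1), of n "Suc n" x x]
      l1_ball_subset_growing_squares [OF assms(1), of n "Suc n" x y] that assms(2)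
    by (auto simp: l1_dist_def)
  have arc: "(x, y) \<in> parcs (growing_squares c (Suc n)) \<longleftrightarrow>
     x \<in> pverts (growing_squares c (Suc n)) \<and> y \<in> pverts (growing_squares c (Suc n)) \<and> l1_dist x y = 1"
    for x y
    by (simp add: growing_squares_def grid_graph_def)
  have d: "l1_dist x y \<le> 1 \<longleftrightarrow> x = y \<or> l1_dist x y = 1" for x y
    by (cases x; cases y) (auto simp: l1_dist_def)
  show ?thesis
    unfolding closed_nbhd_def using V by (auto simp: arc d)
qed

text \<open>One step back along a geodesic: \<open>z\<close> is \<open>y\<close> moved one unit
  towards \<open>x\<close> in a coordinate where they differ; for \<open>x = y\<close>,
  \<open>sgn 0 = 0\<close> leaves \<open>z = y\<close>.\<close>

lemma l1_dist_intermediate: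
  assumes "l1_dist x y \<le> k + 1" "k \<ge> 0"
  shows "\<exists>z. l1_dist x z \<le> k \<and> l1_dist z y \<le> 1"
proof -
  obtain a b c d where xy: "x = (a, b)" "y = (c, d)"
    by fastforce
  show ?thesis
  proof (cases "a = c")
    case False
    then show ?thesis
      using assms xy by (intro exI [of _ "(c - sgn (c - a), d)"]) (auto simp: l1_dist_def sgn_if)
  next
    case True
    then show ?thesis
      using assms xy by (intro exI [of _ "(c, d - sgn (d - b))"]) (auto simp: l1_dist_def sgn_if)
  qed
qed

lemma l1_dist_triangle: "l1_dist x z \<le> l1_dist x y + l1_dist y z"
  by (simp add: l1_dist_def)

text \<open>Without boundary effects each step enlarges every ball by one. Arbitrary sequences are
  allowed, so the formula is available before validity of the greedy choice is shown.\<close>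

lemma burning_set_growing_squares:
  assumes "c \<ge> 1" "\<And>n. v n \<in> pverts (growing_squares c n)"
  shows "burning_set (growing_squares c) (\<lambda>n. Some (v n)) n =
     {y. \<exists>m\<le>n. l1_dist (v m) y \<le> int n - int m}"
proof (induction n)
  case 0
  have "l1_dist (v 0) y \<le> 0 \<longleftrightarrow> y = v 0" for y
    by (cases y; cases "v 0") (auto simp: l1_dist_def)
  then show ?case
    by auto
next
  case (Suc n)
  let ?B = "burning_set (growing_squares c) (\<lambda>n. Some (v n)) n"
  have sub: "?B \<subseteq> pverts (growing_squares c n)"
    using Suc.IH l1_ball_subset_growing_squares [OF assms(1) _ assms(2)] by auto
  have "(\<exists>x\<in>?B. l1_dist x y \<le> 1) \<or> y = v (Suc n) \<longleftrightarrow>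
      (\<exists>m\<le>Suc n. l1_dist (v m) y \<le> int (Suc n) - int m)" (is "?l \<longleftrightarrow> ?r") for y
  proof
    assume ?l
    then show ?r
    proof
      assume "\<exists>x\<in>?B. l1_dist x y \<le> 1"
      then obtain x m where "m \<le> n" "l1_dist (v m) x \<le> int n - int m" "l1_dist x y \<le> 1"
        using Suc.IH by auto
      then show ?r
        using l1_dist_triangle [of "v m" y x] by (intro exI [of _ m]) auto
    next
      assume "y = v (Suc n)"
      then show ?r
        by (intro exI [of _ "Suc n"]) (simp add: l1_dist_def)
    qed
  next
    assume ?r
    then obtain m where m: "m \<le> Suc n" "l1_dist (v m) y \<le> int (Suc n) - int m"
      by blast
    show ?l
    proof (cases "m = Suc n")
      case True
      then have "y = v (Suc n)"
        using m(2) by (cases y; cases "v (Suc n)") (auto simp: l1_dist_def)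
      then show ?l ..
    next
      case False
      then have "m \<le> n"
        using m(1) by simp
      then obtain z where "l1_dist (v m) z \<le> int n - int m" "l1_dist z y \<le> 1"
        using l1_dist_intermediate [of "v m" y "int n - int m"] m(2) by auto
      then show ?l
        using Suc.IH \<open>m \<le> n\<close> by blast
    qed
  qed
  moreover have "burning_set (growing_squares c) (\<lambda>n. Some (v n)) (Suc n)
      = {y. (\<exists>x\<in>?B. l1_dist x y \<le> 1) \<or> y = v (Suc n)}"
    by (auto simp: closed_nbhd_growing_squares [OF assms(1) sub])
  ultimately show ?case
    by simp
qed

lemma l1_dist_norm_diff: "l1_dist (0, 0) y - l1_dist (0, 0) x \<le> l1_dist x y"
  by (simp add: l1_dist_def)

subsection \<open>Greedy activation\<close>

text \<open>\<open>q\<close> is the preferred schedule, \<open>f\<close> the fallback. The radius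
  \<open>n - i\<close> already includes the spread at time \<open>n\<close>, since validity refers
  to the neighbourhood of the previous burning set.\<close>

fun greedy :: "(nat \<Rightarrow> int \<times> int) \<Rightarrow> (nat \<Rightarrow> int \<times> int) \<Rightarrow> nat \<Rightarrow> int \<times> int" where
  "greedy q f n =
     (if \<exists>i\<in>{..<n}. l1_dist (greedy q f i) (q n) \<le> int n - int i then f n else q n)"

declare greedy.simps [simp del]

lemma greedy_cases: "greedy q f n = q n \<or> greedy q f n = f n"
  by (subst (1 2) greedy.simps) auto

text \<open>A chosen \<open>q n\<close> is far from all earlier choices by the test itself, a chosen
  \<open>f n\<close> by \<open>fq\<close> or \<open>ff\<close>, according to the kind of the earlier
  choice. A rejected \<open>q n\<close> is already covered by an earlier ball, so it burns in either
  case.\<close>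

lemma valid_activation_sequence_greedy:
  fixes c :: real and q f :: "nat \<Rightarrow> int \<times> int"
  defines "G \<equiv> growing_squares c"
  defines "v \<equiv> \<lambda>n. Some (greedy q f n)"
  assumes c: "c \<ge> 1"
    and q: "\<And>n. q n \<in> pverts (G n)"
    and f: "\<And>n. f n \<in> pverts (G n)"
    and fq: "\<And>m n. m < n \<Longrightarrow> l1_dist (q m) (f n) > int n - int m"
    and ff: "\<And>m n. m < n \<Longrightarrow> l1_dist (f m) (f n) > int n - int m"
  shows "valid_activation_sequence G v"
    and "q n \<in> burning_set G v n"
proof -
  have V: "greedy q f n \<in> pverts (G n)" for n
    using greedy_cases [of q f n] q f by metis
  have B: "burning_set G v n = {y. \<exists>m\<le>n. l1_dist (greedy q f m) y \<le> int n - int m}" for n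
    using burning_set_growing_squares [OF c V [unfolded G_def]] unfolding G_def v_def by blast
  have sub: "burning_set G v n \<subseteq> pverts (G n)" for n
    using B l1_ball_subset_growing_squares [OF c _ V [unfolded G_def]] unfolding G_def by auto
  have far: "l1_dist (greedy q f m) (greedy q f n) > int n - int m" if "m < n" for m n
  proof (cases "\<exists>i\<in>{..<n}. l1_dist (greedy q f i) (q n) \<le> int n - int i")
    case True
    then have "greedy q f n = f n"
      by (subst greedy.simps) (rule if_P)
    then show ?thesis
      using greedy_cases [of q f m] fq [OF that] ff [OF that] by auto
  next
    case False
    then have "greedy q f n = q n"
      by (subst greedy.simps) (rule if_not_P)
    then show ?thesis
      using False that by (auto simp: not_le)
  qed
  have "greedy q f (Suc n) \<notin> closed_nbhd (G (Suc n)) (burning_set G v n)" for n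
  proof
    assume "greedy q f (Suc n) \<in> closed_nbhd (G (Suc n)) (burning_set G v n)"
    then obtain x m where "m \<le> n" "l1_dist (greedy q f m) x \<le> int n - int m"
      "l1_dist x (greedy q f (Suc n)) \<le> 1"
      using closed_nbhd_growing_squares [OF c sub [unfolded G_def]] B unfolding G_def by auto
    then show False
      using l1_dist_triangle [of "greedy q f m" "greedy q f (Suc n)" x] far [of m "Suc n"] by auto
  qed
  then show "valid_activation_sequence G v"
    using V by (auto simp: valid_activation_sequence_def activation_sequence_def v_def)
  show "q n \<in> burning_set G v n"
  proof (cases "\<exists>i\<in>{..<n}. l1_dist (greedy q f i) (q n) \<le> int n - int i")
    case True
    then show ?thesis
      unfolding B by (auto intro: less_imp_le)
  next
    case False
    then have "greedy q f n = q n"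
      by (subst greedy.simps) (rule if_not_P)
    then show ?thesis
      unfolding B by (auto simp: l1_dist_def)
  qed
qed

subsection \<open>Lattice points in an \<open>\<ell>\<^sub>1\<close>-ball cut off by a square\<close>

text \<open>For \<open>k < R - N\<close> the column at \<open>x = R - k\<close> has
  \<open>2 * k + 1\<close> points, and odd numbers sum to a square. Truncated subtraction covers
  \<open>R \<le> N\<close>, where the cap is empty.\<close>

lemma card_l1_ball_cap:
  "card {(x, y). x > int N \<and> \<bar>x\<bar> + \<bar>y\<bar> \<le> int R} = (R - N)\<^sup>2"
  "finite {(x, y). x > int N \<and> \<bar>x\<bar> + \<bar>y\<bar> \<le> int R}"
proof -
  let ?g = "\<lambda>(k, y). (int R - int k, y)"
  let ?S = "SIGMA k:{..<R - N}. {- int k..int k}"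
  have eq: "{(x, y). x > int N \<and> \<bar>x\<bar> + \<bar>y\<bar> \<le> int R} = ?g ` ?S"
  proof (intro equalityI subsetI)
    fix p
    assume "p \<in> {(x, y). x > int N \<and> \<bar>x\<bar> + \<bar>y\<bar> \<le> int R}"
    then show "p \<in> ?g ` ?S"
      by (intro image_eqI [of _ _ "(nat (int R - fst p), snd p)"]) auto
  qed auto
  have "inj_on ?g ?S"
    by (auto simp: inj_on_def)
  then have "card (?g ` ?S) = (\<Sum>k<R - N. card {- int k..int k})"
    by (simp add: card_image card_SigmaI)
  also have "\<dots> = (\<Sum>k<R - N. 2 * k + 1)"
    by (intro sum.cong) auto
  also have "(\<Sum>k<d. 2 * k + 1) = d\<^sup>2" for d :: nat
    by (induction d) (auto simp: power2_eq_square)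
  finally show "card {(x, y). x > int N \<and> \<bar>x\<bar> + \<bar>y\<bar> \<le> int R} = (R - N)\<^sup>2"
    by (simp only: eq)
  show "finite {(x, y). x > int N \<and> \<bar>x\<bar> + \<bar>y\<bar> \<le> int R}"
    unfolding eq by auto
qed

text \<open>The square cuts four congruent caps off the ball. Caps at adjacent sides are disjoint
  because a common point would have norm at least \<open>2 * N + 2\<close>.\<close>

lemma card_square_Int_l1_ball:
  assumes "R \<le> 2 * N + 1"
  shows "card ({- int N..int N} \<times> {- int N..int N} \<inter> {p. l1_dist (0, 0) p \<le> int R}) + 4 * (R - N)\<^sup>2
    = 2 * R\<^sup>2 + 2 * R + 1"
proof -
  define C where "C N = {(x, y). x > int N \<and> \<bar>x\<bar> + \<bar>y\<bar> \<le> int R}" for N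
  have C: "card (C N) = (R - N)\<^sup>2" "finite (C N)" for N
    unfolding C_def by (fact card_l1_ball_cap)+
  let ?n = "\<lambda>(x, y). (- x, y) :: int \<times> int" and ?s = "\<lambda>(x, y). (y, x) :: int \<times> int"
  have inj: "inj_on ?n X" "inj_on ?s X" for X
    by (auto simp: inj_on_def)
  have cards: "card (?n ` C N) = (R - N)\<^sup>2" "card (?s ` C N) = (R - N)\<^sup>2"
      "card (?s ` ?n ` C N) = (R - N)\<^sup>2" for N
    by (simp_all add: card_image inj C)
  define D where "D = {p. l1_dist (0, 0) p \<le> int R}"
  define Q where "Q = {- int N..int N} \<times> {- int N..int N} \<inter> D"
  have mem: "(x, y) \<in> D \<longleftrightarrow> \<bar>x\<bar> + \<bar>y\<bar> \<le> int R" for x y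
    by (simp add: D_def l1_dist_def)
  have img: "(x, y) \<in> ?n ` X \<longleftrightarrow> (- x, y) \<in> X" "(x, y) \<in> ?s ` X \<longleftrightarrow> (y, x) \<in> X" for x y X
    by force+
  have memC: "(x, y) \<in> C k \<longleftrightarrow> x > int k \<and> \<bar>x\<bar> + \<bar>y\<bar> \<le> int R" 
    "(x, y) \<in> ?n ` C k \<longleftrightarrow> x < - int k \<and> \<bar>x\<bar> + \<bar>y\<bar> \<le> int R"
    "(x, y) \<in> ?s ` C k \<longleftrightarrow> y > int k \<and> \<bar>x\<bar> + \<bar>y\<bar> \<le> int R"
    "(x, y) \<in> ?s ` ?n ` C k \<longleftrightarrow> y < - int k \<and> \<bar>x\<bar> + \<bar>y\<bar> \<le> int R"
    for x y k
    unfolding img by (auto simp: C_def)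
  \<comment> \<open>The full ball is its central column plus two caps with threshold 0, each of
    \<open>R\<^sup>2\<close> points.\<close>
  have "D = ({0} \<times> {- int R..int R}) \<union> (C 0 \<union> ?n ` C 0)"
    by (auto simp: mem memC set_eq_iff)
  also have "card \<dots> = card ({0 :: int} \<times> {- int R..int R}) + (card (C 0) + card (?n ` C 0))"
    by (subst card_Un_disjoint; (subst card_Un_disjoint)?) (auto simp: C memC)
  finally have D: "card D = 2 * R\<^sup>2 + 2 * R + 1"
    by (simp add: cards C)
  have "D = Q \<union> ((C N \<union> ?n ` C N) \<union> (?s ` C N \<union> ?s ` ?n ` C N))"
    by (auto simp: Q_def mem memC set_eq_iff)
  also have "card \<dots> = card Q + ((card (C N) + card (?n ` C N)) + (card (?s ` C N) + card (?s ` ?n ` C N)))"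
  proof (subst card_Un_disjoint)
    show "card Q + card ((C N \<union> ?n ` C N) \<union> (?s ` C N \<union> ?s ` ?n ` C N))
       = card Q + ((card (C N) + card (?n ` C N)) + (card (?s ` C N) + card (?s ` ?n ` C N)))"
    proof (subst card_Un_disjoint)
      show "(C N \<union> ?n ` C N) \<inter> (?s ` C N \<union> ?s ` ?n ` C N) = {}"
        using assms by (auto simp: memC disjoint_iff)
      show "card Q + (card (C N \<union> ?n ` C N) + card (?s ` C N \<union> ?s ` ?n ` C N))
       = card Q + ((card (C N) + card (?n ` C N)) + (card (?s ` C N) + card (?s ` ?n ` C N)))"
        by (subst (1 2) card_Un_disjoint) (auto simp: memC C)
    qed (auto simp: C)
    show "Q \<inter> ((C N \<union> ?n ` C N) \<union> (?s ` C N \<union> ?s ` ?n ` C N)) = {}"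
      by (auto simp: Q_def memC disjoint_iff)
  qed (auto simp: C Q_def)
  finally show ?thesis
    unfolding Q_def [symmetric] D_def [symmetric] by (simp add: D cards C)
qed

text \<open>Dividing numerator and denominator by \<open>n\<^sup>2\<close> leaves a continuous
  expression in the three ratios and \<open>1 / n\<close>. The separate \<open>M\<close> lets a
  shape from an earlier time be measured against the current square.\<close>

lemma tendsto_card_square_Int_l1_ball:
  fixes R N M :: "nat \<Rightarrow> nat"
  assumes RN: "\<And>n. R n \<le> 2 * N n + 1"
    and R: "(\<lambda>n. real (R n) / real n) \<longlonglongrightarrow> r"
    and N: "(\<lambda>n. real (N n) / real n) \<longlonglongrightarrow> c"
    and M: "(\<lambda>n. real (M n) / real n) \<longlonglongrightarrow> c"
    and c: "c > 0"
  shows "(\<lambda>n. real (card ({- int (N n)..int (N n)} \<times> {- int (N n)..int (N n)}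
               \<inter> {p. l1_dist (0, 0) p \<le> int (R n)})) / (2 * real (M n) + 1)\<^sup>2)
     \<longlonglongrightarrow> (2 * r\<^sup>2 - 4 * (max 0 (r - c))\<^sup>2) / (4 * c\<^sup>2)"
proof -
  let ?K = "\<lambda>n. card ({- int (N n)..int (N n)} \<times> {- int (N n)..int (N n)}
               \<inter> {p. l1_dist (0, 0) p \<le> int (R n)})"
  have K: "real (?K n) = 2 * (real (R n))\<^sup>2 + 2 * real (R n) + 1
       - 4 * (max 0 (real (R n) - real (N n)))\<^sup>2" for n
  proof -
    have "real (R n - N n) = max 0 (real (R n) - real (N n))"
      by auto
    then show ?thesis
      using arg_cong [OF card_square_Int_l1_ball [OF RN [of n]], of real] by simp
  qed
  let ?a = "\<lambda>n. real (R n) / real n" and ?b = "\<lambda>n. real (N n) / real n"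
    and ?d = "\<lambda>n. real (M n) / real n" and ?e = "\<lambda>n. 1 / real n"
  have e: "?e \<longlonglongrightarrow> 0"
    by (fact lim_1_over_n)
  have "(\<lambda>n. (2 * (?a n)\<^sup>2 + 2 * ?a n * ?e n + (?e n)\<^sup>2 - 4 * (max 0 (?a n - ?b n))\<^sup>2)
      / (2 * ?d n + ?e n)\<^sup>2) \<longlonglongrightarrow> (2 * r\<^sup>2 + 2 * r * 0 + 0\<^sup>2 - 4 * (max 0 (r - c))\<^sup>2) / (2 * c + 0)\<^sup>2"
    using c by (intro tendsto_intros R N M e) auto
  moreover have "\<forall>\<^sub>F n in sequentially.
      (2 * (?a n)\<^sup>2 + 2 * ?a n * ?e n + (?e n)\<^sup>2 - 4 * (max 0 (?a n - ?b n))\<^sup>2) / (2 * ?d n + ?e n)\<^sup>2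
      = real (?K n) / (2 * real (M n) + 1)\<^sup>2"
    using eventually_gt_at_top [of 0]
  proof eventually_elim
    case (elim n)
    have m: "max 0 (?a n - ?b n) = max 0 (real (R n) - real (N n)) / real n"
      using elim by (auto simp: max_def field_simps)
    have "(2 * (?a n)\<^sup>2 + 2 * ?a n * ?e n + (?e n)\<^sup>2 - 4 * (max 0 (?a n - ?b n))\<^sup>2)
        = real (?K n) / (real n)\<^sup>2"
      unfolding m K using elim by (simp add: field_simps power2_eq_square)
    moreover have "(2 * ?d n + ?e n)\<^sup>2 = (2 * real (M n) + 1)\<^sup>2 / (real n)\<^sup>2"
      using elim by (simp add: add_divide_distrib [symmetric] power_divide)
    ultimately show ?case
      using elim by simp
  qed
  ultimately have "(\<lambda>n. real (?K n) / (2 * real (M n) + 1)\<^sup>2)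
      \<longlonglongrightarrow> (2 * r\<^sup>2 + 2 * r * 0 + 0\<^sup>2 - 4 * (max 0 (r - c))\<^sup>2) / (2 * c + 0)\<^sup>2"
    by (rule Lim_transform_eventually)
  then show ?thesis
    by (simp add: power_mult_distrib)
qed

subsection \<open>Phases of length \<open>O(n\<^bsup>3/4\<^esup>)\<close>\<close>

definition root4 :: "nat \<Rightarrow> nat" where
  "root4 n = nat \<lfloor>root 4 (real n)\<rfloor>"

text \<open>This adjunction identifies phase \<open>s\<close> with the times from
  \<open>s ^ 4\<close> up to, but excluding, \<open>Suc s ^ 4\<close>.\<close>

lemma le_root4_iff: "s \<le> root4 n \<longleftrightarrow> s ^ 4 \<le> n"
proof -
  have "s \<le> root4 n \<longleftrightarrow> real s \<le> root 4 (real n)"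
    by (simp add: root4_def le_nat_iff le_floor_iff)
  also have "\<dots> \<longleftrightarrow> root 4 (real s ^ 4) \<le> root 4 (real n)"
    by (simp add: real_root_power_cancel)
  also have "\<dots> \<longleftrightarrow> s ^ 4 \<le> n"
    by (simp flip: of_nat_power)
  finally show ?thesis .
qed

lemma root4_power_le: "root4 n ^ 4 \<le> n"
  using le_root4_iff by blast

lemma root4_less: "n < Suc (root4 n) ^ 4"
  using le_root4_iff [of "Suc (root4 n)" n] by simp

lemma root4_eqI: "s ^ 4 \<le> n \<Longrightarrow> n < Suc s ^ 4 \<Longrightarrow> root4 n = s"
  using le_root4_iff [of s n] le_root4_iff [of "Suc s" n] by simp

lemma root4_mono: "m \<le> n \<Longrightarrow> root4 m \<le> root4 n"
  using root4_power_le [of m] by (simp add: le_root4_iff)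

lemma root4_bounds:
  "real (root4 n) \<le> real n powr (1 / 4)" "real n powr (1 / 4) \<le> real (root4 n) + 1"
proof -
  have "root 4 (real n) = real n powr (1 / 4)"
    by (cases "n = 0") (simp_all add: root_powr_inverse)
  then show "real (root4 n) \<le> real n powr (1 / 4)" "real n powr (1 / 4) \<le> real (root4 n) + 1"
    by (auto simp: root4_def)
qed

lemma filterlim_root4: "filterlim root4 at_top sequentially"
  unfolding filterlim_at_top eventually_sequentially using le_root4_iff by (metis le_trans)

text \<open>Allowance for the excess of a filler's norm over \<open>r * n\<close>; the constant
  absorbs rounding.\<close>

definition slack :: "nat \<Rightarrow> int" where
  "slack n = int (root4 n) + int (floor_log n) + 3"

lemma slack_mono: "m \<le> n \<Longrightarrow> slack m \<le> slack n"
  using root4_mono floor_log_le_iff by (simp add: slack_def add_mono)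

lemma floor_log_le_log: "n > 0 \<Longrightarrow> real (floor_log n) \<le> log 2 (real n)"
  using floor_log_exp2_le [of n] by (intro le_log2_of_power) auto

lemma slack_sublinear: "(\<lambda>n. real_of_int (slack n) / real n) \<longlonglongrightarrow> 0"
proof (rule tendsto_sandwich)
  show "\<forall>\<^sub>F n in sequentially. 0 \<le> real_of_int (slack n) / real n"
    by (simp add: slack_def)
  show "\<forall>\<^sub>F n in sequentially. real_of_int (slack n) / real n
      \<le> (real n powr (1 / 4) + log 2 (real n) + 3) / real n"
    using eventually_gt_at_top [of 0]
    by eventually_elim
      (use root4_bounds floor_log_le_log in \<open>auto simp: slack_def intro!: divide_right_mono add_mono\<close>)
  show "(\<lambda>n. (real n powr (1 / 4) + log 2 (real n) + 3) / real n) \<longlonglongrightarrow> 0"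
    by real_asymp
qed simp

lemma ceiling_mult_over_n:
  assumes "(\<lambda>n. real (t n) / real n) \<longlonglongrightarrow> 1" "c \<ge> 0"
  shows "(\<lambda>n. real (nat \<lceil>c * real (t n)\<rceil>) / real n) \<longlonglongrightarrow> c"
    and "(\<lambda>n. real (nat \<lfloor>c * real (t n)\<rfloor>) / real n) \<longlonglongrightarrow> c"
proof -
  have l: "(\<lambda>n. c * (real (t n) / real n)) \<longlonglongrightarrow> c * 1"
    by (intro tendsto_intros assms)
  have u: "(\<lambda>n. c * (real (t n) / real n) + 1 / real n) \<longlonglongrightarrow> c * 1 + 0"
     "(\<lambda>n. c * (real (t n) / real n) - 1 / real n) \<longlonglongrightarrow> c * 1 - 0"
    by (intro tendsto_intros assms lim_1_over_n)+
  have ce: "real (nat \<lceil>c * real (t n)\<rceil>) = of_int \<lceil>c * real (t n)\<rceil>"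
     "real (nat \<lfloor>c * real (t n)\<rfloor>) = of_int \<lfloor>c * real (t n)\<rfloor>" for n
    using assms(2) by (auto intro!: of_nat_nat order_trans [OF _ ceiling_mono [of 0]])
  show "(\<lambda>n. real (nat \<lceil>c * real (t n)\<rceil>) / real n) \<longlonglongrightarrow> c"
  proof (rule tendsto_sandwich)
    show "\<forall>\<^sub>F n in sequentially. real (nat \<lceil>c * real (t n)\<rceil>) / real n \<le> c * (real (t n) / real n) + 1 / real n"
      unfolding ce by (intro always_eventually allI) 
       (use of_int_ceiling_le_add_one in \<open>auto simp: add_divide_distrib [symmetric] intro!: divide_right_mono\<close>)
    show "\<forall>\<^sub>F n in sequentially. c * (real (t n) / real n) \<le> real (nat \<lceil>c * real (t n)\<rceil>) / real n"
      unfolding ce by (intro always_eventually allI) (auto intro!: divide_right_mono)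
  qed (use l u in simp_all)
  show "(\<lambda>n. real (nat \<lfloor>c * real (t n)\<rfloor>) / real n) \<longlonglongrightarrow> c"
  proof (rule tendsto_sandwich)
    show "\<forall>\<^sub>F n in sequentially. c * (real (t n) / real n) - 1 / real n \<le> real (nat \<lfloor>c * real (t n)\<rfloor>) / real n"
      unfolding ce by (intro always_eventually allI) 
        (use real_of_int_floor_ge_diff_one in \<open>auto simp: diff_divide_distrib [symmetric] intro!: divide_right_mono\<close>)
    show "\<forall>\<^sub>F n in sequentially. real (nat \<lfloor>c * real (t n)\<rfloor>) / real n \<le> c * (real (t n) / real n)"
      unfolding ce by (intro always_eventually allI) (auto intro!: divide_right_mono)
  qed (use l u in simp_all)
qed

text \<open>The lower bound on the burning set lags two phases behind; this lag is asymptotically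
  negligible.\<close>

lemma root4_shift_power_over_n: "(\<lambda>n. real ((root4 n - 2) ^ 4) / real n) \<longlonglongrightarrow> 1"
proof (rule tendsto_sandwich)
  show "\<forall>\<^sub>F n in sequentially. (real n powr (1 / 4) - 3) ^ 4 / real n \<le> real ((root4 n - 2) ^ 4) / real n"
    \<comment> \<open>As \<open>81 = 3 ^ 4\<close>, the base \<open>n powr (1 / 4) - 3\<close> is
      nonnegative, which monotonicity of the power needs. The 3 is the shift by 2 plus a rounding
      error of 1.\<close>
    using eventually_ge_at_top [of 81]
  proof eventually_elim
    case (elim n)
    then have "3 \<le> root4 n"
      by (simp add: le_root4_iff)
    moreover have "3 \<le> real n powr (1 / 4)"
      using root4_bounds(1) [of n] \<open>3 \<le> root4 n\<close> by linarith
    ultimately show ?case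
      using root4_bounds(2) [of n]
      by (auto intro!: divide_right_mono power_mono simp: of_nat_diff)
  qed
  show "\<forall>\<^sub>F n in sequentially. real ((root4 n - 2) ^ 4) / real n \<le> 1"
  proof (intro always_eventually allI)
    fix n
    have "(root4 n - 2) ^ 4 \<le> n"
      by (rule order_trans [OF power_mono root4_power_le]) auto
    then show "real ((root4 n - 2) ^ 4) / real n \<le> 1"
      by (simp only: divide_le_eq_1 of_nat_le_iff) auto
  qed
  show "(\<lambda>n. (real n powr (1 / 4) - 3) ^ 4 / real n) \<longlonglongrightarrow> 1"
    by real_asymp
qed simp

subsection \<open>Net points\<close>

text \<open>Lattice version of the dilate by \<open>n\<close> of the target shape.\<close>

definition core :: "real \<Rightarrow> real \<Rightarrow> nat \<Rightarrow> (int \<times> int) set" where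
  "core c r n = pverts (growing_squares c n) \<inter> {p. l1_dist (0, 0) p \<le> \<lfloor>r * real n\<rfloor>}"

lemma zero_in_core:
  assumes "c \<ge> 0" "r \<ge> 0"
  shows "(0, 0) \<in> core c r n"
proof -
  have "0 \<le> c * real n" "0 \<le> r * real n"
    using assms by auto
  then have "0 \<le> \<lceil>c * real n\<rceil>" "0 \<le> \<lfloor>r * real n\<rfloor>"
    by linarith+
  then show ?thesis
    by (simp add: core_def pverts_growing_squares l1_dist_def)
qed

lemma core_mono: 
  assumes "c \<ge> 0" "r \<ge> 0" "m \<le> n"
  shows "core c r m \<subseteq> core c r n"
proof -
  have "\<lceil>c * real m\<rceil> \<le> \<lceil>c * real n\<rceil>" "\<lfloor>r * real m\<rfloor> \<le> \<lfloor>r * real n\<rfloor>"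
    using assms by (auto intro!: ceiling_mono floor_mono mult_left_mono)
  then show ?thesis
    by (auto simp: core_def pverts_growing_squares)
qed

text \<open>Schedules the points of \<open>A\<close> on the time slots \<open>T\<close>; surplus
  slots get arbitrary values.\<close>

lemma ex_surjection_of_card_le:
  assumes "finite A" "finite T" "card A \<le> card T"
  shows "\<exists>e. A \<subseteq> e ` T"
proof -
  obtain h where h: "h ` A \<subseteq> T" "inj_on h A"
    using card_le_inj [OF assms] by blast
  have "A \<subseteq> inv_into A h ` T"
  proof
    fix a
    assume "a \<in> A"
    with h show "a \<in> inv_into A h ` T"
      by (intro image_eqI [of _ _ "h a"]) auto
  qed
  then show ?thesis
    by (intro exI [where x = "inv_into A h"])
qed

text \<open>Both coordinates are rounded towards zero to multiples of \<open>s ^ 3\<close>. This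
  neither leaves the square nor increases the norm, so the net point stays in the core.\<close>

lemma ex_grid_point:
  assumes "c \<ge> 0" "s > 0" "p \<in> core c r (s ^ 4)"
  shows "\<exists>i\<in>{- (\<lceil>c * s\<rceil> + 1)..\<lceil>c * s\<rceil> + 1}. \<exists>j\<in>{- (\<lceil>c * s\<rceil> + 1)..\<lceil>c * s\<rceil> + 1}.
    (int s ^ 3 * i, int s ^ 3 * j) \<in> core c r (s ^ 4) \<and>
    l1_dist (int s ^ 3 * i, int s ^ 3 * j) p \<le> 2 * int s ^ 3"
proof -
  define h where "h = int s ^ 3"
  have h: "h > 0"
    using assms by (simp add: h_def)
  have trunc: "\<exists>i\<in>{- (\<lceil>c * s\<rceil> + 1)..\<lceil>c * s\<rceil> + 1}. \<bar>h * i\<bar> \<le> \<bar>x\<bar> \<and> \<bar>h * i - x\<bar> \<le> h"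
    if x: "\<bar>x\<bar> \<le> \<lceil>c * real (s ^ 4)\<rceil>" for x
  proof -
    define k where "k = \<bar>x\<bar> div h"
    have k: "k \<ge> 0" "h * k \<le> \<bar>x\<bar>" "\<bar>x\<bar> < h * k + h"
    proof -
      have "h * k + \<bar>x\<bar> mod h = \<bar>x\<bar>"
        by (simp add: k_def)
      moreover have "0 \<le> \<bar>x\<bar> mod h" "\<bar>x\<bar> mod h < h"
        using h by simp_all
      ultimately show "h * k \<le> \<bar>x\<bar>" "\<bar>x\<bar> < h * k + h"
        by linarith+
      show "k \<ge> 0"
        using h by (simp add: k_def pos_imp_zdiv_nonneg_iff)
    qed
    \<comment> \<open>Rounding up the half-side costs at most 1, hence at most \<open>h\<close>;
      after division by \<open>h\<close> the index exceeds \<open>c * s\<close> by at most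
      1.\<close>
    have "real_of_int (h * k) \<le> c * real (s ^ 4) + 1"
      using k(2) x by linarith
    also have "\<dots> \<le> of_int h * (c * s) + of_int h * 1"
    proof (rule add_mono)
      show "c * real (s ^ 4) \<le> of_int h * (c * s)"
        by (simp add: h_def power_numeral_reduce)
      show "1 \<le> of_int h * (1 :: real)"
        using h by simp
    qed
    finally have "of_int h * real_of_int k \<le> of_int h * (c * s + 1)"
      by (simp add: algebra_simps)
    then have "real_of_int k \<le> c * s + 1"
      using h by (simp add: mult_le_cancel_left_pos)
    then have "k \<le> \<lceil>c * s\<rceil> + 1"
      by linarith
    then show ?thesis
      using k h by (intro bexI [of _ "if x \<ge> 0 then k else - k"]) (auto simp: abs_mult)
  qed
  obtain x y where p: "p = (x, y)"
    by fastforce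
  have "\<bar>x\<bar> \<le> \<lceil>c * real (s ^ 4)\<rceil>" "\<bar>y\<bar> \<le> \<lceil>c * real (s ^ 4)\<rceil>"
    using assms(3) unfolding core_def p pverts_growing_squares by auto
  with trunc obtain i j where ij: "i \<in> {- (\<lceil>c * s\<rceil> + 1)..\<lceil>c * s\<rceil> + 1}"
      "j \<in> {- (\<lceil>c * s\<rceil> + 1)..\<lceil>c * s\<rceil> + 1}"
      "\<bar>h * i\<bar> \<le> \<bar>x\<bar>" "\<bar>h * i - x\<bar> \<le> h" "\<bar>h * j\<bar> \<le> \<bar>y\<bar>" "\<bar>h * j - y\<bar> \<le> h"
    by metis
  have xy: "\<bar>x\<bar> \<le> \<lceil>c * real (s ^ 4)\<rceil>" "\<bar>y\<bar> \<le> \<lceil>c * real (s ^ 4)\<rceil>"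
      "\<bar>x\<bar> + \<bar>y\<bar> \<le> \<lfloor>r * real (s ^ 4)\<rfloor>"
    using assms(3) unfolding core_def p pverts_growing_squares l1_dist_def by auto
  have "\<bar>h * i\<bar> \<le> \<lceil>c * real (s ^ 4)\<rceil>" "\<bar>h * j\<bar> \<le> \<lceil>c * real (s ^ 4)\<rceil>"
    using xy(1,2) ij(3,5) by (blast intro: order_trans)+
  moreover have "\<bar>h * i\<bar> + \<bar>h * j\<bar> \<le> \<lfloor>r * real (s ^ 4)\<rfloor>"
    using add_mono [OF ij(3,5)] xy(3) by (rule order_trans)
  ultimately have "(h * i, h * j) \<in> core c r (s ^ 4)"
    by (simp only: core_def pverts_growing_squares l1_dist_def mem_Times_iff Int_iff abs_le_iff
      mem_Collect_eq fst_conv snd_conv atLeastAtMost_iff diff_0 abs_minus_cancel) auto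
  moreover have "l1_dist (h * i, h * j) p \<le> 2 * h"
    using add_mono [OF ij(4,6)] by (simp add: p l1_dist_def)
  moreover note ij(1,2)
  ultimately show ?thesis
    unfolding h_def by blast
qed

lemma Suc_power4: "Suc s ^ 4 = s ^ 4 + 4 * s ^ 3 + 6 * s ^ 2 + 4 * s + 1"
  by (simp add: power4_eq_xxxx power3_eq_cube power2_eq_square algebra_simps)

text \<open>Phase \<open>s\<close> has more than \<open>4 * s ^ 3\<close> time slots but only
  \<open>O(s\<^sup>2)\<close> net points, so all of them fit once \<open>s\<close> is large.
  Allowing every large \<open>s0\<close> lets the fillers share the same threshold.\<close>

lemma ex_net_sequence:
  fixes c r :: real
  assumes "c > 0" and r: "r \<ge> 0"
  shows "\<forall>\<^sub>F s0 in sequentially. \<exists>q. (\<forall>m. q m \<in> core c r m) \<and> (\<forall>m. root4 m < s0 \<longrightarrow> q m = (0, 0)) \<and>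
     (\<forall>s\<ge>s0. \<forall>p\<in>core c r (s ^ 4). \<exists>m. root4 m = s \<and> l1_dist (q m) p \<le> 2 * int s ^ 3)"
proof -
  have c: "c \<ge> 0"
    using \<open>c > 0\<close> by simp
  have "\<forall>\<^sub>F s in sequentially. (2 * (c * real s + 2) + 1)\<^sup>2 \<le> 4 * real s ^ 3"
    using \<open>c > 0\<close> by real_asymp
  then obtain s1 where s1: "\<forall>s\<ge>s1. (2 * (c * real s + 2) + 1)\<^sup>2 \<le> 4 * real s ^ 3"
    unfolding eventually_sequentially by (rule exE)
  define W where "W s = {- (\<lceil>c * real s\<rceil> + 1)..\<lceil>c * real s\<rceil> + 1}" for s :: nat
  define A where "A s = (\<lambda>(i, j). (int s ^ 3 * i, int s ^ 3 * j)) ` (W s \<times> W s)" for s :: nat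
  define T where "T s = {s ^ 4..<Suc s ^ 4}" for s :: nat
  have cardA: "card (A s) \<le> card (T s)" if "s \<ge> s1" for s
  proof -
    have "0 \<le> c * real s"
      using c by simp
    then have cs: "0 \<le> \<lceil>c * real s\<rceil>"
      by linarith
    have "card (A s) \<le> card (W s \<times> W s)"
      unfolding A_def by (intro card_image_le) (auto simp: W_def)
    also have "\<dots> = (nat (2 * (\<lceil>c * real s\<rceil> + 1) + 1))\<^sup>2"
      by (simp add: W_def card_cartesian_product power2_eq_square)
    finally have "real (card (A s)) \<le> real ((nat (2 * (\<lceil>c * real s\<rceil> + 1) + 1))\<^sup>2)"
      by (rule of_nat_mono)
    also have "\<dots> = (2 * (of_int \<lceil>c * real s\<rceil> + 1) + 1)\<^sup>2"
      using cs by simp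
    also have "\<dots> \<le> (2 * (c * real s + 2) + 1)\<^sup>2"
    proof (rule power_mono)
      have "0 \<le> real_of_int \<lceil>c * real s\<rceil>" "real_of_int \<lceil>c * real s\<rceil> \<le> c * real s + 1"
        using cs by simp_all
      then show "2 * (real_of_int \<lceil>c * real s\<rceil> + 1) + 1 \<le> 2 * (c * real s + 2) + 1"
        "0 \<le> 2 * (real_of_int \<lceil>c * real s\<rceil> + 1) + 1"
        unfolding distrib_left by linarith+
    qed
    also have "\<dots> \<le> 4 * real s ^ 3"
      using s1 that by blast
    also have "\<dots> = real (4 * s ^ 3)"
      by simp
    finally have "card (A s) \<le> 4 * s ^ 3"
      by (simp only: of_nat_le_iff)
    also have "\<dots> \<le> card (T s)"
      by (simp add: T_def Suc_power4)
    finally show ?thesis .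
  qed
  have "\<exists>e. A s \<subseteq> e ` T s" if "s \<ge> s1" for s
    using cardA [OF that] by (intro ex_surjection_of_card_le) (auto simp: A_def W_def T_def)
  then obtain e where e: "A s \<subseteq> e s ` T s" if "s \<ge> s1" for s
    by metis
  \<comment> \<open>The bound \<open>Suc s1\<close> also makes \<open>s\<close> positive, as
    \<open>ex_grid_point\<close> requires.\<close>
  have "\<exists>q. (\<forall>m. q m \<in> core c r m) \<and> (\<forall>m. root4 m < s0 \<longrightarrow> q m = (0, 0)) \<and>
     (\<forall>s\<ge>s0. \<forall>p\<in>core c r (s ^ 4). \<exists>m. root4 m = s \<and> l1_dist (q m) p \<le> 2 * int s ^ 3)"
    if s0: "s0 \<ge> Suc s1" for s0
  proof -
    \<comment> \<open>Grid points outside the core and surplus values of \<open>e\<close> are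
      replaced by the origin, which lies in every core.\<close>
    define q where "q m = (if s0 \<le> root4 m \<and> e (root4 m) m \<in> core c r (root4 m ^ 4)
        then e (root4 m) m else (0, 0))" for m
    have "q m \<in> core c r m" for m
      using core_mono [OF c r root4_power_le] zero_in_core [OF c r] by (auto simp: q_def)
    moreover have "q m = (0, 0)" if "root4 m < s0" for m
      using that by (simp add: q_def)
    moreover have "\<exists>m. root4 m = s \<and> l1_dist (q m) p \<le> 2 * int s ^ 3"
      if sp: "s \<ge> s0" "p \<in> core c r (s ^ 4)" for s p
    proof -
      obtain i j where ij: "i \<in> W s" "j \<in> W s" "(int s ^ 3 * i, int s ^ 3 * j) \<in> core c r (s ^ 4)"
          "l1_dist (int s ^ 3 * i, int s ^ 3 * j) p \<le> 2 * int s ^ 3"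
        using ex_grid_point [OF c _ sp(2)] sp(1) s0 unfolding W_def by auto
      then have "(int s ^ 3 * i, int s ^ 3 * j) \<in> A s"
        by (auto simp: A_def)
      then obtain m where m: "m \<in> T s" "e s m = (int s ^ 3 * i, int s ^ 3 * j)"
        using e [of s] s0 sp(1) by fastforce
      then have "root4 m = s"
        by (auto simp: T_def intro: root4_eqI)
      then have "q m = (int s ^ 3 * i, int s ^ 3 * j)"
        using m ij(3) sp(1) by (simp add: q_def)
      then show ?thesis
        using ij(4) \<open>root4 m = s\<close> by auto
    qed
    ultimately show ?thesis
      by blast
  qed
  then show ?thesis
    unfolding eventually_sequentially by blast
qed

subsection \<open>Fillers\<close>

text \<open>For small \<open>m\<close> and \<open>c = 1\<close> there is little room: in the dyadic phase
  \<open>2\<^sup>p \<le> m < 2\<^sup>p\<^sup>+\<^sup>1\<close> the fillers run along the sphere of radius \<open>m + p + 1\<close>, first through the first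
  quadrant and then, for the last \<open>p\<close> steps of the phase, through the second.\<close>

definition early_filler :: "nat \<Rightarrow> int \<times> int" where
  "early_filler m =
     (let p = floor_log m; i = int m - 2 ^ p; j = i + int p - 2 ^ p
      in if m = 0 then (0, 0)
         else if j < 0 then (int p + 1 + 2 * i, 2 ^ p - i)
         else (- (int p + 1 + 2 * j), 2 * 2 ^ p - int p - j))"

text \<open>Keeps the second-quadrant leg of the early fillers inside the square: it yields
  \<open>m + 3 * p + 1 \<le> 4 * 2 ^ p\<close>, so the first coordinate is at least
  \<open>- m\<close>.\<close>

lemma three_mult_le_two_power: "3 * int p \<le> 2 * 2 ^ p"
proof (induction p)
  case (Suc p)
  then show ?case
    by (cases p) (auto simp: power_Suc)
qed simp

text \<open>Both legs become linear in \<open>m\<close>, \<open>p\<close> and \<open>P\<close>, so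
  linear arithmetic settles the geometry below.\<close>

lemma early_filler_cases:
  fixes m p :: nat and P :: int
  assumes "m > 0" "floor_log m = p" "P = 2 ^ p"
  shows "P \<le> int m" "int m < 2 * P" "int p < P" "3 * int p \<le> 2 * P"
    and "int m + int p < 2 * P \<and> early_filler m = (int p + 1 + 2 * int m - 2 * P, 2 * P - int m) \<or>
         int m + int p \<ge> 2 * P \<and>
         early_filler m = (4 * P - 2 * int m - 3 * int p - 1, 4 * P - int m - 2 * int p)"
proof -
  have "int p < int (2 ^ p)"
    using less_exp [of p] by (simp only: of_nat_less_iff)
  then show "int p < P" "3 * int p \<le> 2 * P"
    using three_mult_le_two_power [of p] by (simp_all add: assms(3))
  have "int (2 ^ p) \<le> int m" "int m < int (2 * 2 ^ p)"
    using floor_log_exp2_le [OF assms(1)] floor_log_exp2_gt [of m]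
    unfolding assms(2) by (simp_all only: of_nat_le_iff of_nat_less_iff)
  then show "P \<le> int m" "int m < 2 * P"
    by (auto simp: assms(3))
  show "int m + int p < 2 * P \<and> early_filler m = (int p + 1 + 2 * int m - 2 * P, 2 * P - int m) \<or>
         int m + int p \<ge> 2 * P \<and>
         early_filler m = (4 * P - 2 * int m - 3 * int p - 1, 4 * P - int m - 2 * int p)"
    using assms(1) unfolding early_filler_def Let_def assms(2) assms(3) [symmetric] by simp
qed

text \<open>On the first leg the first coordinate is at most \<open>m\<close> exactly when
  \<open>m + p < 2 * P\<close>; this dictates the moment of the switch to the second
  quadrant.\<close>

lemma early_filler:
  assumes "m > 0"
  shows "l1_dist (0, 0) (early_filler m) = int m + int (floor_log m) + 1"
    and "early_filler m \<in> {- int m..int m} \<times> {- int m..int m}"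
proof -
  obtain P :: int where "P = 2 ^ floor_log m"
    by blast
  note m = early_filler_cases [OF assms refl this]
  show "l1_dist (0, 0) (early_filler m) = int m + int (floor_log m) + 1"
    using m unfolding l1_dist_def by (elim disjE conjE; simp only: fst_conv snd_conv; linarith)
  show "early_filler m \<in> {- int m..int m} \<times> {- int m..int m}"
    using m unfolding mem_Times_iff atLeastAtMost_iff
    by (elim disjE conjE; simp only: fst_conv snd_conv; linarith)
qed

text \<open>Between dyadic phases \<open>floor_log\<close> adds at least 1 to the growth of the
  norm. Within a leg the first coordinate moves by 2 per step; across the legs both coordinates
  together give enough distance, as \<open>m \<ge> P\<close>.\<close>

lemma early_filler_dist:
  assumes "m < n"
  shows "l1_dist (early_filler m) (early_filler n) > int n - int m"
\<comment> \<open>Time 0 needs separate care: \<open>floor_log 0 = floor_log 1\<close>, but its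
  filler is the origin.\<close>
proof (cases "m > 0 \<and> floor_log m = floor_log n")
  case False
  then have "m = 0 \<or> floor_log m < floor_log n"
    using floor_log_le_iff [of m n] assms by auto
  moreover have "early_filler 0 = (0, 0)"
    by (simp add: early_filler_def)
  ultimately show ?thesis
    using early_filler(1) [of m] early_filler(1) [of n] assms
      l1_dist_norm_diff [of "early_filler n" "early_filler m"]
    by (cases "m = 0") auto
next
  case True
  then have "m > 0" "floor_log m = floor_log n" "n > 0"
    using assms by auto
  obtain P :: int where "P = 2 ^ floor_log n"
    by blast
  note m = early_filler_cases [OF \<open>m > 0\<close> \<open>floor_log m = floor_log n\<close> this]
    and n = early_filler_cases [OF \<open>n > 0\<close> refl this]
  have "int m < int n"
    using assms by simp
  then show ?thesis
    using m(1-4) n(1,2) m(5) n(5) unfolding l1_dist_def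
    by (elim disjE conjE; simp only: fst_conv snd_conv; linarith)
qed

text \<open>The final 1 puts fillers beyond the reach of net points, \<open>root4\<close> makes the
  norm jump between phases, and \<open>floor_log\<close> matches the norm of the early
  fillers.\<close>

definition late_radius :: "real \<Rightarrow> nat \<Rightarrow> int" where
  "late_radius r m = \<lceil>r * real m\<rceil> + int (root4 m) + int (floor_log m) + 1"

text \<open>Each phase starts near the diagonal, where a sphere of radius less than
  \<open>2 * c * m\<close> has room inside the square.\<close>

definition late_filler :: "real \<Rightarrow> nat \<Rightarrow> int \<times> int" where
  "late_filler r m =
     (let x = late_radius r m div 2 + 2 * (int m - int (root4 m ^ 4)) in (x, late_radius r m - x))"

lemma late_radius_mono:
  assumes "r \<ge> 1" "m \<le> n"
  shows "late_radius r m + (int n - int m) + (int (root4 n) - int (root4 m)) \<le> late_radius r n"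
  using ceiling_mult_diff [OF assms] floor_log_le_iff [OF assms(2)]
  unfolding late_radius_def by linarith

text \<open>The first coordinate alone suffices: half the radius does not decrease, and the other
  summand gains 2 per step.\<close>

lemma late_filler_dist:
  assumes "r \<ge> 1" "m < n" "root4 m = root4 n"
  shows "l1_dist (late_filler r m) (late_filler r n) > int n - int m"
proof -
  have "late_radius r m \<le> late_radius r n"
    using late_radius_mono [OF assms(1) less_imp_le [OF assms(2)]] assms(2,3) by linarith
  then have "late_radius r m div 2 \<le> late_radius r n div 2"
    by (rule zdiv_mono1) simp
  then have "fst (late_filler r n) - fst (late_filler r m) \<ge> 2 * (int n - int m)"
    unfolding late_filler_def Let_def fst_conv assms(3) right_diff_distrib by linarith
  then show ?thesis
    using assms(2) unfolding l1_dist_def right_diff_distrib by linarith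
qed

text \<open>The sideways displacement within a phase is \<open>O(m powr (3 / 4))\<close>, whereas
  the room around the diagonal is linear in \<open>m\<close> because
  \<open>r < 2 * c\<close>.\<close>

lemma late_filler:
  fixes c r :: real
  assumes "r \<ge> 1" "r < 2 * c"
  shows "\<forall>\<^sub>F m in sequentially. late_filler r m \<in> pverts (growing_squares c m) \<and>
    l1_dist (0, 0) (late_filler r m) = late_radius r m"
proof -
  define t where "t m = real m powr (1 / 4)" for m
  \<comment> \<open>Four times the bound \<open>4 * s ^ 3 + 6 * s\<^sup>2 + 4 * s\<close> on the
    time spent in the phase, plus the lower-order terms of \<open>late_radius\<close>. Comparison
    with \<open>d * m\<close> bounds the coordinates above, comparison with \<open>m\<close> keeps
    the second one nonnegative.\<close>
  define b where "b m = 16 * t m ^ 3 + 24 * t m ^ 2 + 17 * t m + log 2 (real m) + 10" for m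
  define d where "d = 2 * c - r"
  have "d > 0"
    using assms by (simp add: d_def)
  then have "\<forall>\<^sub>F m in sequentially. b m \<le> d * real m"
    unfolding b_def t_def by real_asymp
  moreover have "\<forall>\<^sub>F m in sequentially. b m \<le> real m"
    unfolding b_def t_def by real_asymp
  ultimately show ?thesis
    using eventually_gt_at_top [of 0]
  proof eventually_elim
    case (elim m)
    define s where "s = root4 m"
    define l where "l = int m - int (s ^ 4)"
    define k where "k = late_radius r m"
    have s: "real s \<le> t m"
      unfolding s_def t_def by (rule root4_bounds)
    then have s23: "real s ^ 2 \<le> t m ^ 2" "real s ^ 3 \<le> t m ^ 3"
      by (auto intro: power_mono)
    have "m \<le> s ^ 4 + 4 * s ^ 3 + 6 * s ^ 2 + 4 * s"
      using root4_less [of m] unfolding s_def Suc_power4 by simp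
    then have "real m \<le> real (s ^ 4 + 4 * s ^ 3 + 6 * s ^ 2 + 4 * s)"
      by (rule of_nat_mono)
    then have l: "real_of_int l \<le> 4 * real s ^ 3 + 6 * real s ^ 2 + 4 * real s"
      by (simp add: l_def)
    have "s ^ 4 \<le> m"
      unfolding s_def by (rule root4_power_le)
    then have "l \<ge> 0"
      by (simp only: l_def of_nat_le_iff diff_ge_0_iff_ge)
    have p: "real (floor_log m) \<le> log 2 (real m)" "0 \<le> log 2 (real m)"
      using elim floor_log_le_log by auto
    have "real_of_int k \<le> r * real m + real s + real (floor_log m) + 2"
      using of_int_ceiling_le_add_one [of "r * real m"]
      unfolding k_def late_radius_def s_def of_int_add of_int_of_nat_eq of_int_1 by linarith
    then have "real_of_int k + 4 * real_of_int l + 1 \<le> r * real m + b m"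
      using l s s23 p unfolding b_def by linarith
    also have "\<dots> \<le> 2 * (c * real m)"
      using elim(1) by (simp add: d_def algebra_simps)
    also have "\<dots> \<le> 2 * real_of_int \<lceil>c * real m\<rceil>"
      by simp
    finally have "real_of_int (k + 4 * l + 1) \<le> real_of_int (2 * \<lceil>c * real m\<rceil>)"
      by simp
    then have 1: "k + 4 * l + 1 \<le> 2 * \<lceil>c * real m\<rceil>"
      by (simp only: of_int_le_iff)
    have "4 * real_of_int l \<le> b m"
      using l s s23 p order_trans [OF of_nat_0_le_iff s] unfolding b_def by linarith
    then have "real_of_int (4 * l) \<le> real_of_int (int m)"
      using elim(2) by simp
    then have "4 * l \<le> int m"
      by (simp only: of_int_le_iff)
    moreover have "int m \<le> k"
      using late_radius_mono [OF assms(1), of 0 m] unfolding k_def late_radius_def by simp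
    ultimately have 2: "4 * l \<le> k"
      by simp
    obtain h where h: "k div 2 = h" "2 * h \<le> k" "k \<le> 2 * h + 1"
      by (cases "even k") (auto elim!: evenE oddE)
    have f: "late_filler r m = (h + 2 * l, k - (h + 2 * l))"
      unfolding late_filler_def Let_def k_def [symmetric] s_def [symmetric] l_def [symmetric] h(1) ..
    have "0 \<le> h + 2 * l" "h + 2 * l \<le> \<lceil>c * real m\<rceil>" "0 \<le> k - (h + 2 * l)" "k - (h + 2 * l) \<le> \<lceil>c * real m\<rceil>"
      using 1 2 h(2,3) \<open>l \<ge> 0\<close> by linarith+
    then show ?case
      unfolding f k_def [symmetric] pverts_growing_squares by (auto simp: l1_dist_def)
  qed
qed

section \<open>Early and late fillers combined\<close>

lemma l1_dist_far:
  "l1_dist (0, 0) y - l1_dist (0, 0) x > k \<Longrightarrow> l1_dist x y > k"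
  using l1_dist_norm_diff [of y x] by linarith

text \<open>For \<open>r = 2 * c\<close> the norm of the corners grows by at least 2 per step and
  dominates each square. Otherwise early fillers are used until phase \<open>s0\<close>; as net
  points stay at the origin until then, early fillers need only outrun a ball about the
  origin.\<close>

lemma ex_filler_sequence:
  fixes c r :: real
  assumes c: "c \<ge> 1" and r: "1 \<le> r" "r \<le> 2 * c"
  shows "\<forall>\<^sub>F s0 in sequentially. \<exists>f. (\<forall>m. f m \<in> pverts (growing_squares c m)) \<and>
     (\<forall>m. real_of_int (l1_dist (0, 0) (f m)) \<le> r * real m + real_of_int (slack m)) \<and>
     (\<forall>m n. m < n \<longrightarrow> l1_dist (f m) (f n) > int n - int m) \<and>
     (\<forall>q. (\<forall>m. q m \<in> core c r m) \<longrightarrow> (\<forall>m. root4 m < s0 \<longrightarrow> q m = (0, 0)) \<longrightarrow>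
        (\<forall>m n. m < n \<longrightarrow> l1_dist (q m) (f n) > int n - int m))"
proof (cases "r = 2 * c")
  case True
  define f where "f m = (\<lceil>c * real m\<rceil>, \<lceil>c * real m\<rceil>)" for m :: nat
  have pos: "0 \<le> \<lceil>c * real m\<rceil>" for m
  proof -
    have "0 \<le> c * real m"
      using c by simp
    then show ?thesis
      by linarith
  qed
  have norm: "l1_dist (0, 0) (f m) = 2 * \<lceil>c * real m\<rceil>" for m
    using pos [of m] by (simp add: f_def l1_dist_def)
  have far: "l1_dist x (f n) > int n - int m" if "m < n" "x \<in> pverts (growing_squares c m)" for x m n
  proof (rule l1_dist_far)
    have "l1_dist (0, 0) x \<le> 2 * \<lceil>c * real m\<rceil>"
      using that(2) by (cases x) (auto simp: pverts_growing_squares l1_dist_def)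
    then show "int n - int m < l1_dist (0, 0) (f n) - l1_dist (0, 0) x"
      using ceiling_mult_diff [OF c less_imp_le [OF that(1)]] that(1) unfolding norm by linarith
  qed
  have V: "f m \<in> pverts (growing_squares c m)" for m
    using pos [of m] by (simp add: f_def pverts_growing_squares)
  have "real_of_int (l1_dist (0, 0) (f m)) \<le> r * real m + real_of_int (slack m)" for m
    using of_int_ceiling_le_add_one [of "c * real m"]
    unfolding norm True slack_def of_int_add of_int_mult of_int_of_nat_eq of_int_numeral by linarith
  with V far show ?thesis
    by (intro always_eventually allI exI [of _ f]) (auto simp: core_def)
next
  case False
  then obtain M where M: "\<And>m. m \<ge> M \<Longrightarrow> late_filler r m \<in> pverts (growing_squares c m) \<and>
      l1_dist (0, 0) (late_filler r m) = late_radius r m"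
    using late_filler [OF r(1), of c] r(2) unfolding eventually_sequentially by fastforce
  \<comment> \<open>\<open>s0 \<ge> M\<close> makes the late fillers well placed;
    \<open>s0 \<ge> 1\<close> makes the norm jump strictly from early to late fillers.\<close>
  have "\<exists>f. (\<forall>m. f m \<in> pverts (growing_squares c m)) \<and>
     (\<forall>m. real_of_int (l1_dist (0, 0) (f m)) \<le> r * real m + real_of_int (slack m)) \<and>
     (\<forall>m n. m < n \<longrightarrow> l1_dist (f m) (f n) > int n - int m) \<and>
     (\<forall>q. (\<forall>m. q m \<in> core c r m) \<longrightarrow> (\<forall>m. root4 m < s0 \<longrightarrow> q m = (0, 0)) \<longrightarrow>
        (\<forall>m n. m < n \<longrightarrow> l1_dist (q m) (f n) > int n - int m))" if s0: "s0 \<ge> max M 1" for s0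
  proof -
    define f where "f m = (if root4 m < s0 then early_filler m else late_filler r m)" for m
    have late: "f m = late_filler r m" "f m \<in> pverts (growing_squares c m)"
      "l1_dist (0, 0) (f m) = late_radius r m" if "s0 \<le> root4 m" for m
    proof -
      have "root4 m \<le> root4 m ^ 4"
        using s0 that by (intro self_le_power) auto
      then have "M \<le> m"
        using root4_power_le [of m] s0 that by linarith
      with that M show "f m = late_filler r m" "f m \<in> pverts (growing_squares c m)"
        "l1_dist (0, 0) (f m) = late_radius r m"
        by (simp_all add: f_def)
    qed
    have early0: "early_filler 0 = (0, 0)"
      by (simp add: early_filler_def)
    have cm: "int m \<le> \<lceil>c * real m\<rceil>" "int m \<le> \<lceil>r * real m\<rceil>" for m
      using ceiling_mult_diff [OF c, of 0 m] ceiling_mult_diff [OF r(1), of 0 m] by simp_all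
    have early: "f m = early_filler m" "f m \<in> pverts (growing_squares c m)"
      "l1_dist (0, 0) (f m) \<le> int m + int (floor_log m) + 1"
      if "root4 m < s0" for m
    proof -
      show *: "f m = early_filler m"
        using that by (simp add: f_def)
      have "early_filler m \<in> {- int m..int m} \<times> {- int m..int m}"
        by (cases "m = 0") (auto simp: early0 intro!: early_filler(2))
      then show "f m \<in> pverts (growing_squares c m)"
        using cm(1) [of m] unfolding * pverts_growing_squares mem_Times_iff atLeastAtMost_iff by linarith
      show "l1_dist (0, 0) (f m) \<le> int m + int (floor_log m) + 1"
        unfolding * by (cases "m = 0") (simp_all add: early0 early_filler(1), simp add: l1_dist_def)
    qed
    have V: "f m \<in> pverts (growing_squares c m)" for m
      using early(2) late(2) by (cases "root4 m < s0") auto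
    have "real_of_int (l1_dist (0, 0) (f m)) \<le> r * real m + real_of_int (slack m)" for m
    proof (cases "root4 m < s0")
      case True
      have "real m \<le> r * real m"
        using mult_right_mono [OF r(1), of "real m"] by simp
      moreover have "real_of_int (l1_dist (0, 0) (f m)) \<le> real_of_int (int m + int (floor_log m) + 1)"
        using early(3) [OF True] by (simp only: of_int_le_iff)
      ultimately show ?thesis
        by (simp add: slack_def)
    next
      case False
      then show ?thesis
        using late(3) [of m] of_int_ceiling_le_add_one [of "r * real m"]
        by (simp add: slack_def late_radius_def del: of_int_ceiling_le_add_one)
    qed
    moreover have "l1_dist (f m) (f n) > int n - int m" if "m < n" for m n
    proof (cases "root4 n < s0")
      case True
      then have "root4 m < s0"
        using root4_mono [of m n] that by simp
      then show ?thesis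
        using early(1) True early_filler_dist [OF that] by simp
    next
      case False
      then have n: "s0 \<le> root4 n"
        by simp
      have mn: "m \<le> n"
        using that by simp
      show ?thesis
      proof (cases "root4 m < s0")
        case True
        show ?thesis
        proof (rule l1_dist_far)
          show "int n - int m < l1_dist (0, 0) (f n) - l1_dist (0, 0) (f m)"
            using early(3) [OF True] late(3) [OF n] cm(2) [of n] floor_log_le_iff [OF mn] n s0
            unfolding late_radius_def by linarith
        qed
      next
        case False
        then have m: "s0 \<le> root4 m"
          by simp
        show ?thesis
        proof (cases "root4 m = root4 n")
          case True
          then show ?thesis
            using late_filler_dist [OF r(1) that] late(1) m n by simp
        next
          case False
          then have "root4 m < root4 n"
            using root4_mono [OF mn] by simp
          then show ?thesis
            using late_radius_mono [OF r(1) mn] late(3) [OF m] late(3) [OF n]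
            by (intro l1_dist_far) linarith
        qed
      qed
    qed
    moreover have "l1_dist (q m) (f n) > int n - int m"
      if q: "\<forall>m. q m \<in> core c r m" "\<forall>m. root4 m < s0 \<longrightarrow> q m = (0, 0)" and "m < n" for q m n
    proof (rule l1_dist_far, cases "root4 n < s0")
      case True
      have "root4 m < s0"
        using root4_mono [of m n] that True by simp
      then have "l1_dist (0, 0) (q m) = 0"
        using q(2) by (simp add: l1_dist_def)
      moreover have "l1_dist (0, 0) (f n) = int n + int (floor_log n) + 1"
        using early(1) [OF True] early_filler(1) [of n] that(3) by simp
      ultimately show "int n - int m < l1_dist (0, 0) (f n) - l1_dist (0, 0) (q m)"
        by simp
    next
      case False
      \<comment> \<open>By time \<open>n\<close> the ball about \<open>q m\<close> reaches norm at
        most \<open>\<lceil>r * n\<rceil>\<close>, which is below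
        \<open>late_radius r n\<close>.\<close>
      have "l1_dist (0, 0) (q m) \<le> \<lfloor>r * real m\<rfloor>"
        using q(1) by (auto simp: core_def)
      also have "\<dots> \<le> \<lceil>r * real m\<rceil>"
        by linarith
      finally show "int n - int m < l1_dist (0, 0) (f n) - l1_dist (0, 0) (q m)"
        using late(3) [of n] False ceiling_mult_diff [OF r(1) less_imp_le [OF that(3)]]
        unfolding late_radius_def by linarith
    qed
    ultimately show ?thesis
      using V by (intro exI [of _ f]) blast
  qed
  then show ?thesis
    unfolding eventually_sequentially by blast
qed

subsection \<open>Realizing the density\<close>

theorem theorem1:
  fixes c \<rho> :: real
  assumes "c \<ge> 1"
    and "\<rho> \<in> {1 / (2 * c\<^sup>2)..1}"
  shows "\<exists>v :: nat \<Rightarrow> int \<times> int.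
           (\<forall>n. v n \<in> pverts (growing_squares c n)) \<and>
           valid_activation_sequence (growing_squares c) (\<lambda>n. Some (v n)) \<and>
           has_burning_density (growing_squares c) (\<lambda>n. Some (v n)) \<rho>"
proof -
  \<comment> \<open>Limiting area fraction: a ball of area \<open>2 * x\<^sup>2\<close> less four
    caps of area \<open>(x - c)\<^sup>2\<close>, in a square of area \<open>4 * c\<^sup>2\<close>.
    The endpoints 1 and \<open>2 * c\<close> give \<open>1 / (2 * c\<^sup>2)\<close> and 1.\<close>
  define \<phi> where "\<phi> x = (2 * x\<^sup>2 - 4 * (max 0 (x - c))\<^sup>2) / (4 * c\<^sup>2)" for x
  have "\<exists>r. 1 \<le> r \<and> r \<le> 2 * c \<and> \<phi> r = \<rho>"
  proof (rule IVT')
    show "\<phi> 1 \<le> \<rho>" "\<rho> \<le> \<phi> (2 * c)" "1 \<le> 2 * c"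
      using assms by (auto simp: \<phi>_def power2_eq_square)
    show "continuous_on {1..2 * c} \<phi>"
      unfolding \<phi>_def using assms by (intro continuous_intros) auto
  qed
  then obtain r where r: "1 \<le> r" "r \<le> 2 * c" and \<rho>: "\<phi> r = \<rho>"
    by blast
  have c: "c > 0" "c \<ge> 0" and r0: "r \<ge> 0"
    using assms(1) r(1) by auto
  from eventually_happens' [OF sequentially_bot
      eventually_conj [OF ex_net_sequence [OF c(1) r0] ex_filler_sequence [OF assms(1) r]]]
  obtain s0 q f where *: "\<forall>m. q m \<in> core c r m" "\<forall>m. root4 m < s0 \<longrightarrow> q m = (0, 0)"
      "\<forall>s\<ge>s0. \<forall>p\<in>core c r (s ^ 4). \<exists>m. root4 m = s \<and> l1_dist (q m) p \<le> 2 * int s ^ 3"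
      "\<forall>m. f m \<in> pverts (growing_squares c m)"
      "\<forall>m. real_of_int (l1_dist (0, 0) (f m)) \<le> r * real m + real_of_int (slack m)"
      "\<forall>m n. m < n \<longrightarrow> l1_dist (f m) (f n) > int n - int m"
      "\<forall>q. (\<forall>m. q m \<in> core c r m) \<longrightarrow> (\<forall>m. root4 m < s0 \<longrightarrow> q m = (0, 0)) \<longrightarrow>
        (\<forall>m n. m < n \<longrightarrow> l1_dist (q m) (f n) > int n - int m)"
    by (elim exE conjE) (rule that)
  note q = *(1)[rule_format] and net = *(3)[rule_format] and f = *(4,5)[rule_format]
    and ff = *(6)[rule_format] and fq = *(7)[rule_format, OF *(1)[rule_format] *(2)[rule_format]]
  define v where "v = greedy q f"
  define B where "B = burning_set (growing_squares c) (\<lambda>n. Some (v n))"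
  have qV: "q m \<in> pverts (growing_squares c m)" for m
    using q by (auto simp: core_def)
  have v: "v n = q n \<or> v n = f n" for n
    unfolding v_def by (rule greedy_cases)
  have V: "v n \<in> pverts (growing_squares c n)" for n
    using v [of n] qV f(1) by metis
  have B: "B n = {y. \<exists>m\<le>n. l1_dist (v m) y \<le> int n - int m}" for n
    unfolding B_def by (rule burning_set_growing_squares [OF assms(1) V])
  note greedy = valid_activation_sequence_greedy [OF assms(1) qV f(1) fq ff]
  have qB: "q n \<in> B n" for n
    unfolding B_def v_def by (rule greedy(2))
  have BV: "B n \<subseteq> pverts (growing_squares c n)" for n
    unfolding B using l1_ball_subset_growing_squares [OF assms(1) _ V] by auto

  \<comment> \<open>The burning set between two balls cut off by squares\<close>
  define N where "N n = nat \<lceil>c * real n\<rceil>" for n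
  define K where "K N R = {- int N..int N} \<times> {- int N..int N} \<inter> {p. l1_dist (0, 0) p \<le> int R}" for N R
  have N: "int (N n) = \<lceil>c * real n\<rceil>" for n
  proof -
    have "0 \<le> c * real n"
      using c by simp
    then show ?thesis
      unfolding N_def by linarith
  qed
  have pverts: "pverts (growing_squares c n) = {- int (N n)..int (N n)} \<times> {- int (N n)..int (N n)}" for n
    by (simp add: pverts_growing_squares N)
  have Nn: "(\<lambda>n. real (N n) / real n) \<longlonglongrightarrow> c"
    unfolding N_def
  proof (rule ceiling_mult_over_n [OF _ c(2)])
    show "(\<lambda>n. real n / real n) \<longlonglongrightarrow> 1"
      by real_asymp
  qed

  \<comment> \<open>Radius \<open>2 * N n\<close> already covers the square; capping there ensures
    the radius bound of the counting lemma, also when \<open>r\<close> is close to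
    \<open>2 * c\<close>.\<close>
  define R where "R n = min (nat (\<lfloor>r * real n\<rfloor> + slack n)) (2 * N n)" for n
  have slack0: "slack n \<ge> 0" for n
    by (simp add: slack_def)
  have fl0: "\<lfloor>r * real n\<rfloor> \<ge> 0" for n
    using r0 by simp
  \<comment> \<open>Since \<open>r \<ge> 1\<close>, the norm bound \<open>r * m + slack m\<close>
    grows at least as fast as the balls spread.\<close>
  have upper: "B n \<subseteq> K (N n) (R n)" for n
  proof
    fix y
    assume y: "y \<in> B n"
    then obtain m where m: "m \<le> n" "l1_dist (v m) y \<le> int n - int m"
      by (auto simp: B)
    have "real_of_int (l1_dist (0, 0) (v m)) \<le> r * real m + real_of_int (slack m)"
      using v [of m]
    proof
      assume "v m = q m"
      then have "l1_dist (0, 0) (v m) \<le> \<lfloor>r * real m\<rfloor>"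
        using q [of m] by (simp add: core_def)
      then have "real_of_int (l1_dist (0, 0) (v m)) \<le> r * real m"
        by (simp add: le_floor_iff)
      then show ?thesis
        using slack0 [of m] by linarith
    qed (use f(2) in simp)
    moreover have "real_of_int (slack m) \<le> real_of_int (slack n)"
      using slack_mono [OF m(1)] by simp
    moreover have "real_of_int (l1_dist (v m) y) \<le> real n - real m"
      using m(2) by linarith
    moreover have "real n - real m \<le> r * (real n - real m)"
      using r(1) m(1) by (simp add: mult_le_cancel_right1)
    moreover have "real_of_int (l1_dist (0, 0) y) \<le> real_of_int (l1_dist (0, 0) (v m) + l1_dist (v m) y)"
      using l1_dist_triangle by (simp only: of_int_le_iff)
    ultimately have "real_of_int (l1_dist (0, 0) y - slack n) \<le> r * real n"
      by (simp add: algebra_simps)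
    then have "l1_dist (0, 0) y - slack n \<le> \<lfloor>r * real n\<rfloor>"
      by (simp only: le_floor_iff)
    moreover have "y \<in> {- int (N n)..int (N n)} \<times> {- int (N n)..int (N n)}"
      using BV y pverts by blast
    moreover from this have "l1_dist (0, 0) y \<le> 2 * int (N n)"
      by (cases y) (auto simp: l1_dist_def)
    ultimately show "y \<in> K (N n) (R n)"
      using slack0 [of n] fl0 [of n] by (auto simp: K_def R_def)
  qed

  define t where "t n = (root4 n - 2) ^ 4" for n
  define L where "L n = nat \<lfloor>r * real (t n)\<rfloor>" for n
  \<comment> \<open>Net points of phase \<open>s = root4 n - 2\<close> burn before
    \<open>Suc s ^ 4\<close>. The phase in between is longer than \<open>2 * s ^ 3\<close>, so their
    balls cover the core by time \<open>n\<close>.\<close>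
  have lower: "K (N (t n)) (L n) \<subseteq> B n" if n: "root4 n \<ge> s0 + 2" for n
  proof
    fix p
    assume "p \<in> K (N (t n)) (L n)"
    then have "p \<in> core c r ((root4 n - 2) ^ 4)"
      using fl0 [of "t n"] by (simp add: K_def core_def pverts L_def t_def)
    moreover have "s0 \<le> root4 n - 2"
      using n by simp
    ultimately obtain m where m: "root4 m = root4 n - 2" "l1_dist (q m) p \<le> 2 * int (root4 n - 2) ^ 3"
      using net by blast
    define s where "s = root4 m"
    have s: "root4 n = Suc (Suc s)"
      using m(1) n by (simp add: s_def)
    obtain i where i: "i \<le> m" "l1_dist (v i) (q m) \<le> int m - int i"
      using qB [of m] by (auto simp: B)
    have "m + 2 * s ^ 3 \<le> Suc s ^ 4 + 4 * Suc s ^ 3"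
      using root4_less [of m] power_mono [of s "Suc s" 3] unfolding s_def by linarith
    also have "\<dots> \<le> root4 n ^ 4"
      unfolding s Suc_power4 [of "Suc s"] by simp
    also have "\<dots> \<le> n"
      by (rule root4_power_le)
    finally have mn: "m + 2 * s ^ 3 \<le> n" .
    then have "int (m + 2 * s ^ 3) \<le> int n"
      by (simp only: of_nat_le_iff)
    moreover have "l1_dist (q m) p \<le> 2 * int s ^ 3"
      using m by (simp add: s_def)
    ultimately have "l1_dist (v i) p \<le> int n - int i"
      using i l1_dist_triangle [of "v i" p "q m"] by simp
    moreover have "i \<le> n"
      using i(1) mn by simp
    ultimately show "p \<in> B n"
      by (auto simp: B)
  qed

  \<comment> \<open>Passage to the limit\<close>
  have cardV: "real (card (pverts (growing_squares c n))) = (2 * real (N n) + 1)\<^sup>2" for n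
    by (simp add: pverts card_cartesian_product power2_eq_square nat_add_distrib nat_mult_distrib algebra_simps)
  have fin: "finite (K M R)" for M R
    by (simp add: K_def)
  have t: "(\<lambda>n. real (t n) / real n) \<longlonglongrightarrow> 1"
    unfolding t_def by (rule root4_shift_power_over_n)
  have rc: "\<lfloor>r * real n\<rfloor> \<le> 2 * int (N n)" for n
  proof -
    have "r * real n \<le> 2 * (c * real n)"
      using mult_right_mono [OF r(2), of "real n"] by simp
    then show ?thesis
      unfolding N by linarith
  qed
  have "(\<lambda>n. real (card (B n)) / (2 * real (N n) + 1)\<^sup>2) \<longlonglongrightarrow> \<phi> r"
  proof (rule tendsto_sandwich)
    show "\<forall>\<^sub>F n in sequentially. real (card (K (N (t n)) (L n))) / (2 * real (N n) + 1)\<^sup>2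
        \<le> real (card (B n)) / (2 * real (N n) + 1)\<^sup>2"
      using filterlim_root4 [unfolded filterlim_at_top, rule_format, of "s0 + 2"]
    proof eventually_elim
      case (elim n)
      have "finite (B n)"
        using finite_subset [OF upper fin] .
      then show ?case
        using card_mono [OF _ lower [OF elim]] by (intro divide_right_mono) auto
    qed
    show "\<forall>\<^sub>F n in sequentially. real (card (B n)) / (2 * real (N n) + 1)\<^sup>2
        \<le> real (card (K (N n) (R n))) / (2 * real (N n) + 1)\<^sup>2"
      using card_mono [OF fin upper] by (intro always_eventually allI divide_right_mono) auto
    show "(\<lambda>n. real (card (K (N (t n)) (L n))) / (2 * real (N n) + 1)\<^sup>2) \<longlonglongrightarrow> \<phi> r"
      unfolding K_def \<phi>_def
    proof (rule tendsto_card_square_Int_l1_ball [OF _ _ _ Nn c(1)])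
      show "L n \<le> 2 * N (t n) + 1" for n
        using rc [of "t n"] unfolding L_def by linarith
      show "(\<lambda>n. real (L n) / real n) \<longlonglongrightarrow> r" "(\<lambda>n. real (N (t n)) / real n) \<longlonglongrightarrow> c"
        unfolding L_def N_def using ceiling_mult_over_n [OF t] c(2) r0 by blast+
    qed
    show "(\<lambda>n. real (card (K (N n) (R n))) / (2 * real (N n) + 1)\<^sup>2) \<longlonglongrightarrow> \<phi> r"
      unfolding K_def \<phi>_def
    proof (rule tendsto_card_square_Int_l1_ball [OF _ _ Nn Nn c(1)])
      show "R n \<le> 2 * N n + 1" for n
        by (simp add: R_def)
      have "real (R n) / real n = min (real (nat \<lfloor>r * real n\<rfloor>) / real n + real_of_int (slack n) / real n)
          (2 * (real (N n) / real n))" for n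
      proof -
        have "real (R n) = min (real (nat \<lfloor>r * real n\<rfloor>) + real_of_int (slack n)) (2 * real (N n))"
          using fl0 [of n] slack0 [of n] by (simp add: R_def of_nat_min)
        then show ?thesis
          by (simp add: min_divide_distrib_right add_divide_distrib)
      qed
      moreover have "(\<lambda>n. min (real (nat \<lfloor>r * real n\<rfloor>) / real n + real_of_int (slack n) / real n)
          (2 * (real (N n) / real n))) \<longlonglongrightarrow> min (r + 0) (2 * c)"
      proof (intro tendsto_intros slack_sublinear Nn)
        show "(\<lambda>n. real (nat \<lfloor>r * real n\<rfloor>) / real n) \<longlonglongrightarrow> r"
        proof (rule ceiling_mult_over_n [OF _ r0])
          show "(\<lambda>n. real n / real n) \<longlonglongrightarrow> 1"
            by real_asymp
        qed
      qed
      ultimately show "(\<lambda>n. real (R n) / real n) \<longlonglongrightarrow> r"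
        using r(2) by (simp add: min_absorb1)
    qed
  qed
  then have "has_burning_density (growing_squares c) (\<lambda>n. Some (v n)) \<rho>"
    unfolding has_burning_density_def cardV \<rho> B_def .
  moreover have "valid_activation_sequence (growing_squares c) (\<lambda>n. Some (v n))"
    unfolding v_def by (rule greedy(1))
  ultimately show ?thesis
    using V by blast
qed

end
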